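(* Let $k>2$ be an integer. Suppose $\hat w_k\in\mathbb{R}^{n_1^k}$ is the unique vector of the form $\hat w_k=\Theta_r^{\otimes k}\tilde w_k$, with $\tilde w_k\in\mathbb{R}^{(n_1-n_2)^k}$, that solves $$(\Theta_r^{\otimes k})^\top\,\mathcal{L}_k^{E_{11}^\top}\big(A_{11}^\top-\eta E_{11}^\top\widehat W_2B_1B_1^\top\big)\,\hat w_k=(\Theta_r^{\otimes k})^\top b ,$$ where $$b=-\mathcal{L}_{k-1}^{E_{11}^\top}(N^\top)\,\hat w_{k-1}+\frac{\eta}{4}\sum_{\substack{i,j>2\\ i+j=k+2}} ij\,\operatorname{vec}\Big((E_{11}^{\otimes(i-1)})^\top\widehat W_i^\top B_1B_1^\top\widehat W_jE_{11}^{\otimes(j-1)}\Big).$$ Then $\hat w_k$ is also uniquely determined by the augmented linear system $$\begin{pmatrix}\mathcal{L}_k^{E_{11}^\top}(A_c^\top) & \mathcal{M}_k^{\tilde I}(A_{12})\\ \big(\mathcal{M}_k^{\tilde I}(A_{12})\big)^\top & 0\end{pmatrix}\begin{pmatrix}\hat w\\ \Omega\end{pmatrix}=\begin{pmatrix} b\\ 0\end{pmatrix},\qquad A_c=A_{11}-\eta B_1B_1^\top\widehat W_2E_{11},$$ in the unknowns $\hat w\in\mathbb{R}^{n_1^k}$ and $\Omega$ (a dummy vector of compatible dimension). That is, this system has a solution, and the first block $\hat w$ of any solution equals $\hat w_k$.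
   Context: **Data.** Let $n_1>n_2\ge 1$ and let $m,p\ge1$ be integers. Let $E_{11},A_{11}\in\mathbb{R}^{n_1\times n_1}$ with $E_{11}$ invertible. Let $A_{12}\in\mathbb{R}^{n_1\times n_2}$ have full (column) rank, with $A_{12}^\top E_{11}^{-1}A_{12}$ invertible. Let $N\in\mathbb{R}^{n_1\times n_1^2}$, $B_1\in\mathbb{R}^{n_1\times m}$, $C_1\in\mathbb{R}^{p\times n_1}$, and let $\eta\le 1$ be real. These are the data of the Stokes-type DAE $E_{11}\dot x_1=A_{11}x_1+A_{12}x_2+N(x_1\otimes x_1)+B_1u$, $0=A_{12}^\top x_1$, $y=C_1x_1$ (the case $B_2=0$). **Projector.** Let $\Pi=I_{n_1}-A_{12}(A_{12}^\top E_{11}^{-1}A_{12})^{-1}A_{12}^\top E_{11}^{-1}$. Let $\Theta_\ell,\Theta_r\in\mathbb{R}^{n_1\times(n_1-n_2)}$ be matrices with $\Pi=\Theta_\ell\Theta_r^\top$ and $\Theta_\ell^\top\Theta_r=I_{n_1-n_2}$. Put $E_d=\Theta_r^\top E_{11}\Theta_r$ (which is invertible), $A_d=\Theta_r^\top A_{11}\Theta_r$, $B_d=\Theta_r^\top B_1$, $C_d=C_1\Theta_r$. Assume $(E_d^{-1}A_d,E_d^{-1}B_d)$ is stabilizable and $(E_d^{-1}A_d,C_d)$ is detectable. **Kronecker notation.** $X^{\otimes k}=X\otimes\cdots\otimes X$ ($k$ factors), and $\operatorname{vec}$ stacks the columns of a matrix. For $M\in\mathbb{R}^{q\times n}$ and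 $E\in\mathbb{R}^{n\times n}$, $$\mathcal{L}_k^E(M)=M\otimes E\otimes\cdots\otimes E+E\otimes M\otimes E\otimes\cdots\otimes E+\cdots+E\otimes\cdots\otimes E\otimes M\in\mathbb{R}^{n^{k-1}q\times n^k},$$ a sum of $k$ terms, each with $k$ factors, where $M$ occupies each position once. For matrices $A$ and $B$ with the same number $n$ of rows, $$\mathcal{M}_k^B(A)=\big[\,A\otimes I_n\otimes\cdots\otimes I_n\ \big|\ B\otimes A\otimes I_n\otimes\cdots\otimes I_n\ \big|\ \cdots\ \big|\ B\otimes\cdots\otimes B\otimes A\,\big],$$ the block row matrix whose $i$-th block ($1\le i\le k$) is $B^{\otimes(i-1)}\otimes A\otimes I_n^{\otimes(k-i)}$. **The matrix $\tilde I$.** Choose $n_2$ columns of $A_{12}^\top$ forming a basis of the column space of $A_{12}^\top$. Then $\tilde I\in\mathbb{R}^{n_1\times(n_1-n_2)}$ consists of the columns of $I_{n_1}$ whose indices are those of the remaining (non-basis) columns of $A_{12}^\top$. **Lower-order coefficients.** Let $\widetilde W_2$ be symmetric and such that $W_2=E_d^\top\widetilde W_2E_d$ is the symmetric positive definite solution of the Riccati equation $0=A_d^\top E_d^{-\top}W_2+W_2E_d^{-1}A_d+C_d^\top C_d-\eta W_2E_d^{-1}B_dB_d^\top E_d^{-\top}W_2$. Set $\widehat W_2=\Theta_r\widetilde W_2\Theta_r^\top$ and $\hat w_2=\operatorname{vec}(\widehat W_2)$. For $3\le i\le k-1$, $\hat w_i=\Theta_r^{\otimes i}\tilde w_i\in\mathbb{R}^{n_1^i}$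 denotes the symmetrized solution of the first linear system of the claim with $k$ replaced by $i$ (computed recursively). Here "symmetrized" means averaged over all permutations of the $i$ tensor factors of $\mathbb{R}^{n_1^i}=(\mathbb{R}^{n_1})^{\otimes i}$. For each $i$, $\widehat W_i\in\mathbb{R}^{n_1\times n_1^{i-1}}$ is the matrix with $\operatorname{vec}(\widehat W_i)=\hat w_i$. *)

theory Defs
  imports
    "Jordan_Normal_Form.DL_Rank"
    "Jordan_Normal_Form.Gauss_Jordan_Elimination"
    "Jordan_Normal_Form.Char_Poly"
    "HOL-Combinatorics.Permutations"
    Complex_Main
begin

section \<open>Inverses, definiteness, stabilizability\<close>

text \<open>Only meaningful for invertible square matrices.\<close>
definition mat_inv :: "'a :: field mat \<Rightarrow> 'a mat" where
  "mat_inv A = the (mat_inverse A)"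

definition sym_pos_def :: "real mat \<Rightarrow> bool" where
  "sym_pos_def A \<longleftrightarrow> A\<^sup>T = A \<and>
     (\<forall>x \<in> carrier_vec (dim_row A). x \<noteq> 0\<^sub>v (dim_row A) \<longrightarrow> x \<bullet> (A *\<^sub>v x) > 0)"

definition hurwitz :: "real mat \<Rightarrow> bool" where
  "hurwitz A \<longleftrightarrow> (\<forall>\<mu>. eigenvalue (map_mat complex_of_real A) \<mu> \<longrightarrow> Re \<mu> < 0)"

definition stabilizable :: "real mat \<Rightarrow> real mat \<Rightarrow> bool" where
  "stabilizable A B \<longleftrightarrow> (\<exists>F \<in> carrier_mat (dim_col B) (dim_row A). hurwitz (A + B * F))"

definition detectable :: "real mat \<Rightarrow> real mat \<Rightarrow> bool" where
  "detectable A C \<longleftrightarrow> (\<exists>L \<in> carrier_mat (dim_row A) (dim_row C). hurwitz (A + L * C))"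

section \<open>Kronecker calculus\<close>

definition kron :: "'a :: times mat \<Rightarrow> 'a mat \<Rightarrow> 'a mat" (infixl "\<otimes>\<^sub>K" 72) where
  "A \<otimes>\<^sub>K B = mat (dim_row A * dim_row B) (dim_col A * dim_col B)
     (\<lambda>(i, j). A $$ (i div dim_row B, j div dim_col B) * B $$ (i mod dim_row B, j mod dim_col B))"

text \<open>The empty Kronecker power is the \<open>1 \<times> 1\<close> identity.\<close>
fun kron_pow :: "'a :: semiring_1 mat \<Rightarrow> nat \<Rightarrow> 'a mat" where
  "kron_pow A 0 = 1\<^sub>m 1"
| "kron_pow A (Suc k) = A \<otimes>\<^sub>K kron_pow A k"

text \<open>Column stacking: entry \<open>(i, j)\<close> lands at position \<open>i + j * dim_row A\<close>.\<close>
definition vectorize :: "'a mat \<Rightarrow> 'a vec" where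
  "vectorize A = vec (dim_row A * dim_col A) (\<lambda>r. A $$ (r mod dim_row A, r div dim_row A))"

text \<open>
  \<open>lyap k E M\<close> is the sum over \<open>t < k\<close> of the \<open>k\<close>-fold Kronecker products with \<open>M\<close> in
  position \<open>t\<close> and \<open>E\<close> in all the others. The sum is taken entrywise because the type of
  matrices of arbitrary dimension has no zero.
\<close>
definition lyap :: "nat \<Rightarrow> real mat \<Rightarrow> real mat \<Rightarrow> real mat" where
  "lyap k E M = mat (dim_row E ^ (k - 1) * dim_row M) (dim_col E ^ (k - 1) * dim_col M)
     (\<lambda>(r, c). \<Sum>t<k. (kron_pow E t \<otimes>\<^sub>K M \<otimes>\<^sub>K kron_pow E (k - 1 - t)) $$ (r, c))"

text \<open>
  \<open>block_row k B A\<close> places the blocks with index \<open>t = 0, \<dots>, k - 1\<close> side by side; these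
  have \<open>n ^ k\<close> rows each, but in general different numbers of columns.
\<close>
definition block_row :: "nat \<Rightarrow> real mat \<Rightarrow> real mat \<Rightarrow> real mat" where
  "block_row k B A = mat_of_cols (dim_row A ^ k) (concat
     (map (\<lambda>t. cols (kron_pow B t \<otimes>\<^sub>K A \<otimes>\<^sub>K kron_pow (1\<^sub>m (dim_row A)) (k - 1 - t))) [0..<k]))"

section \<open>Symmetrization of tensors\<close>

text \<open>
  A position \<open>r < n ^ i\<close> of a vector in the \<open>i\<close>-fold tensor power corresponds to the
  multi-index of its \<open>i\<close> base-\<open>n\<close> digits, the most significant digit belonging to the first
  factor. This matches the ordering of \<open>kron\<close>.
\<close>
definition digit :: "nat \<Rightarrow> nat \<Rightarrow> nat \<Rightarrow> nat \<Rightarrow> nat" where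
  "digit n i r s = r div n ^ (i - 1 - s) mod n"

definition undigit :: "nat \<Rightarrow> nat \<Rightarrow> (nat \<Rightarrow> nat) \<Rightarrow> nat" where
  "undigit n i d = (\<Sum>s<i. d s * n ^ (i - 1 - s))"

definition permute_factors :: "nat \<Rightarrow> nat \<Rightarrow> (nat \<Rightarrow> nat) \<Rightarrow> real vec \<Rightarrow> real vec" where
  "permute_factors n i \<pi> v = vec (n ^ i) (\<lambda>r. v $ undigit n i (\<lambda>s. digit n i r (\<pi> s)))"

definition symmetrize :: "nat \<Rightarrow> nat \<Rightarrow> real vec \<Rightarrow> real vec" where
  "symmetrize n i v =
     vec (n ^ i) (\<lambda>r. (\<Sum>\<pi> | \<pi> permutes {..<i}. permute_factors n i \<pi> v $ r) / fact i)"

section \<open>The complementary selection matrix\<close>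

definition (in vec_space) basis_columns :: "'a mat \<Rightarrow> nat set \<Rightarrow> bool" where
  "basis_columns A J \<longleftrightarrow> J \<subseteq> {..<dim_col A} \<and> inj_on (col A) J \<and>
     lin_indpt (col A ` J) \<and> span (col A ` J) = col_space A"

text \<open>
  The columns of the identity whose indices are not in \<open>J\<close>; their order is left open.
\<close>
definition is_complement_selection :: "nat \<Rightarrow> nat set \<Rightarrow> real mat \<Rightarrow> bool" where
  "is_complement_selection n J S \<longleftrightarrow>
     (\<exists>js. distinct js \<and> set js = {..<n} - J \<and> S = mat_of_cols n (map (unit_vec n) js))"

section \<open>The projected linear systems\<close>

text \<open>
  In the following, \<open>W i\<close> is the matrix whose vectorization is the \<open>i\<close>-th coefficient.
\<close>
definition rhs_vec ::
  "real mat \<Rightarrow> real mat \<Rightarrow> real mat \<Rightarrow> real \<Rightarrow> (nat \<Rightarrow> real mat) \<Rightarrow> nat \<Rightarrow> real vec" where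
  "rhs_vec E N B \<eta> W k =
     - (lyap (k - 1) E\<^sup>T N\<^sup>T *\<^sub>v vectorize (W (k - 1))) +
     (\<eta> / 4) \<cdot>\<^sub>v vec (dim_row E ^ k) (\<lambda>r. \<Sum>(i, j) \<in> {(i, j). i > 2 \<and> j > 2 \<and> i + j = k + 2}.
        real (i * j) *
        vectorize ((kron_pow E (i - 1))\<^sup>T * (W i)\<^sup>T * B * B\<^sup>T * W j * kron_pow E (j - 1)) $ r)"

definition solves_projected ::
  "real mat \<Rightarrow> real mat \<Rightarrow> real mat \<Rightarrow> real mat \<Rightarrow> real \<Rightarrow> real mat \<Rightarrow>
   (nat \<Rightarrow> real mat) \<Rightarrow> nat \<Rightarrow> real vec \<Rightarrow> bool" where
  "solves_projected E A N B \<eta> \<Theta> W k v \<longleftrightarrow>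
     (\<exists>u \<in> carrier_vec (dim_col \<Theta> ^ k). v = kron_pow \<Theta> k *\<^sub>v u) \<and>
     (kron_pow \<Theta> k)\<^sup>T *\<^sub>v (lyap k E\<^sup>T (A\<^sup>T - \<eta> \<cdot>\<^sub>m (E\<^sup>T * W 2 * B * B\<^sup>T)) *\<^sub>v v) =
     (kron_pow \<Theta> k)\<^sup>T *\<^sub>v rhs_vec E N B \<eta> W k"

end

theory Submission
  imports Defs
begin

text \<open>
  Write \<open>A\<close> for \<open>A12\<close>, \<open>B\<close> for \<open>It\<close>, \<open>\<Theta>\<close> for \<open>\<Theta>r\<close> and \<open>M\<close> for the block row. The augmented
  system is the projected one with a Lagrange multiplier, and the equivalence rests on two facts
  about \<open>M\<close>: the kernel of \<open>M\<^sup>T\<close> is the range of \<open>kron_pow \<Theta> k\<close>, and the range of \<open>M\<close> is the kernel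
  of \<open>(kron_pow \<Theta> k)\<^sup>T\<close>. Then \<open>M\<^sup>T *\<^sub>v w = 0\<close> is the ansatz
  \<open>w = kron_pow \<Theta> k *\<^sub>v u\<close>, and solvability of \<open>L *\<^sub>v w + M *\<^sub>v \<Omega> = b\<close> for \<open>\<Omega>\<close> is the projected
  equation (\<open>augmented_system_block_row\<close>). So the first components of the solutions of the
  augmented system are exactly the solutions of the projected system, of which \<open>wk\<close> is the only one.
  Nothing about the generalized Lyapunov operator \<open>L\<close> is needed except its dimensions, and the
  symmetry of \<open>What 2\<close>, by which both systems have the same operator.

  Both facts follow from \<open>\<Theta>\<^sup>T * A = 0\<close> and a resolution of the identity
  \<open>A * X + B * (R * \<Theta>\<^sup>T) = 1\<close>. With \<open>Y = R * \<Theta>\<^sup>T\<close>, replacing the identity in one tensor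
  factor after the other by \<open>A * X + B * Y\<close> gives, over the Kronecker factors,
  \<open>1 = (\<Sum>t<k. block k B A t * Z t) + kron_pow (B * Y) k\<close> for suitable matrices \<open>Z t\<close>
  (\<open>telescoping_step\<close>). The
  last term factors through \<open>(kron_pow \<Theta> k)\<^sup>T\<close>, which yields the nontrivial inclusions; the
  others follow from \<open>\<Theta>\<^sup>T * A = 0\<close>.

  The relation \<open>\<Theta>\<^sup>T * A = 0\<close> holds since the projector annihilates \<open>A\<close>. The resolution comes from
  the choice of basis columns (\<open>complement_selection_resolution\<close>): it provides \<open>X\<close> and \<open>Y\<close> with
  \<open>A * X + B * Y = 1\<close> and \<open>Y * A = 0\<close>, and the latter implies that \<open>Y\<close> is fixed by the projector
  \<open>\<Theta>l * \<Theta>\<^sup>T\<close>, so that \<open>R = Y * \<Theta>l\<close>.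
\<close>

section \<open>Kronecker products\<close>

lemma dim_kron [simp]:
  "dim_row (A \<otimes>\<^sub>K B) = dim_row A * dim_row B" "dim_col (A \<otimes>\<^sub>K B) = dim_col A * dim_col B"
  by (auto simp: kron_def)

lemma kron_carrier [simp]:
  assumes "A \<in> carrier_mat a b" "B \<in> carrier_mat c d"
  shows "A \<otimes>\<^sub>K B \<in> carrier_mat (a * c) (b * d)"
  using assms by (auto simp: kron_def)

lemma index_kron:
  assumes "i < dim_row A * dim_row B" "j < dim_col A * dim_col B"
  shows "(A \<otimes>\<^sub>K B) $$ (i, j) =
    A $$ (i div dim_row B, j div dim_col B) * B $$ (i mod dim_row B, j mod dim_col B)"
  using assms by (simp add: kron_def)

lemma div_mod_bounds:
  fixes i a b :: nat
  assumes "i < a * b"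
  shows "i div b < a" "i mod b < b"
  using assms by (auto simp: less_mult_imp_div_less) (metis gr0I mod_less_divisor mult_0_right not_less0)

lemma kron_assoc:
  fixes A B C :: "'a :: semigroup_mult mat"
  shows "A \<otimes>\<^sub>K B \<otimes>\<^sub>K C = A \<otimes>\<^sub>K (B \<otimes>\<^sub>K C)"
proof (rule eq_matI)
  fix i j
  assume "i < dim_row (A \<otimes>\<^sub>K (B \<otimes>\<^sub>K C))" "j < dim_col (A \<otimes>\<^sub>K (B \<otimes>\<^sub>K C))"
  then have i: "i < dim_row A * dim_row B * dim_row C" "i < dim_row A * (dim_row B * dim_row C)"
    and j: "j < dim_col A * dim_col B * dim_col C" "j < dim_col A * (dim_col B * dim_col C)"
    by (simp_all add: mult.assoc)
  have mod_div: "x mod (b * c) div c = x div c mod b" if "0 < c" for x b c :: nat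
    using that mod_mult2_eq[of x c b] by (simp add: mult.commute[of b])
  have mod_mod: "x mod (b * c) mod c = x mod c" for x b c :: nat
    by (simp add: mod_mod_cancel)
  have div_div: "x div (b * c) = x div c div b" for x b c :: nat
    by (simp add: div_mult2_eq mult.commute[of b])
  have c: "0 < dim_row C" "0 < dim_col C"
    using i j by (auto intro: gr0I)
  show "(A \<otimes>\<^sub>K B \<otimes>\<^sub>K C) $$ (i, j) = (A \<otimes>\<^sub>K (B \<otimes>\<^sub>K C)) $$ (i, j)"
    using i j c div_mod_bounds[OF i(1)] div_mod_bounds[OF j(1)]
      div_mod_bounds[OF i(2)] div_mod_bounds[OF j(2)]
    by (simp add: index_kron mod_div mod_mod div_div mult.assoc)
qed (simp_all add: mult.assoc)

lemma sum_div_mod: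
  fixes f :: "nat \<Rightarrow> 'a :: comm_monoid_add"
  shows "(\<Sum>l<a * b. f l) = (\<Sum>i<a. \<Sum>j<b. f (i * b + j))"
proof -
  have "sum f {i * b..<i * b + b} = (\<Sum>j<b. f (i * b + j))" for i
    using sum.shift_bounds_nat_ivl[of f 0 "i * b" b] by (simp add: add.commute atLeast0LessThan)
  then show ?thesis
    by (simp add: sum.nat_group[symmetric])
qed

lemma kron_mult:
  fixes A B C D :: "'a :: comm_semiring_1 mat"
  assumes "A \<in> carrier_mat a b" "C \<in> carrier_mat b c" "B \<in> carrier_mat a' b'" "D \<in> carrier_mat b' c'"
  shows "(A \<otimes>\<^sub>K B) * (C \<otimes>\<^sub>K D) = (A * C) \<otimes>\<^sub>K (B * D)"
proof (rule eq_matI)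
  fix i j
  assume "i < dim_row ((A * C) \<otimes>\<^sub>K (B * D))" "j < dim_col ((A * C) \<otimes>\<^sub>K (B * D))"
  then have i: "i < a * a'" and j: "j < c * c'"
    using assms by auto
  note bounds = div_mod_bounds[OF i] div_mod_bounds[OF j]
  have "((A \<otimes>\<^sub>K B) * (C \<otimes>\<^sub>K D)) $$ (i, j) =
      (\<Sum>l<b * b'. (A \<otimes>\<^sub>K B) $$ (i, l) * (C \<otimes>\<^sub>K D) $$ (l, j))"
    using i j assms by (simp add: scalar_prod_def atLeast0LessThan)
  also have "\<dots> = (\<Sum>l<b * b'. A $$ (i div a', l div b') * B $$ (i mod a', l mod b') *
      (C $$ (l div b', j div c') * D $$ (l mod b', j mod c')))"
    using i j assms by (intro sum.cong) (simp_all add: index_kron)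
  also have "\<dots> = (\<Sum>s<b. \<Sum>t<b'. (A $$ (i div a', s) * C $$ (s, j div c')) *
      (B $$ (i mod a', t) * D $$ (t, j mod c')))"
    by (subst sum_div_mod) (simp add: ac_simps)
  also have "\<dots> = (\<Sum>s<b. A $$ (i div a', s) * C $$ (s, j div c')) *
      (\<Sum>t<b'. B $$ (i mod a', t) * D $$ (t, j mod c'))"
    by (simp add: sum_product)
  also have "\<dots> = ((A * C) \<otimes>\<^sub>K (B * D)) $$ (i, j)"
    using i j assms bounds by (simp add: index_kron scalar_prod_def atLeast0LessThan)
  finally show "((A \<otimes>\<^sub>K B) * (C \<otimes>\<^sub>K D)) $$ (i, j) = ((A * C) \<otimes>\<^sub>K (B * D)) $$ (i, j)" .
qed (use assms in auto)

lemma kron_add_left: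
  fixes A B C :: "'a :: semiring_1 mat"
  assumes "A \<in> carrier_mat a b" "B \<in> carrier_mat a b"
  shows "(A + B) \<otimes>\<^sub>K C = A \<otimes>\<^sub>K C + B \<otimes>\<^sub>K C"
  by (rule eq_matI) (use assms in \<open>auto simp: index_kron div_mod_bounds distrib_right\<close>)

lemma kron_add_right:
  fixes A B C :: "'a :: semiring_1 mat"
  assumes "A \<in> carrier_mat a b" "B \<in> carrier_mat a b"
  shows "C \<otimes>\<^sub>K (A + B) = C \<otimes>\<^sub>K A + C \<otimes>\<^sub>K B"
  by (rule eq_matI) (use assms in \<open>auto simp: index_kron div_mod_bounds distrib_left\<close>)

lemma kron_zero_left:
  fixes B :: "'a :: semiring_1 mat"
  assumes "B \<in> carrier_mat c d"
  shows "0\<^sub>m a b \<otimes>\<^sub>K B = 0\<^sub>m (a * c) (b * d)"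
  by (rule eq_matI) (use assms in \<open>auto simp: index_kron div_mod_bounds\<close>)

lemma kron_zero_right:
  fixes A :: "'a :: semiring_1 mat"
  assumes "A \<in> carrier_mat a b"
  shows "A \<otimes>\<^sub>K 0\<^sub>m c d = 0\<^sub>m (a * c) (b * d)"
  by (rule eq_matI) (use assms in \<open>auto simp: index_kron div_mod_bounds\<close>)

lemma kron_one_left [simp]:
  fixes A :: "'a :: semiring_1 mat"
  shows "1\<^sub>m (Suc 0) \<otimes>\<^sub>K A = A"
  by (rule eq_matI) (auto simp: index_kron)

lemma kron_one_right [simp]:
  fixes A :: "'a :: semiring_1 mat"
  shows "A \<otimes>\<^sub>K 1\<^sub>m (Suc 0) = A"
  by (rule eq_matI) (auto simp: index_kron)

lemma kron_one_one:
  "1\<^sub>m a \<otimes>\<^sub>K 1\<^sub>m b = (1\<^sub>m (a * b) :: 'a :: semiring_1 mat)"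
proof (rule eq_matI)
  fix i j
  assume "i < dim_row (1\<^sub>m (a * b) :: 'a mat)" "j < dim_col (1\<^sub>m (a * b) :: 'a mat)"
  then have i: "i < a * b" and j: "j < a * b"
    by auto
  have "i = j" if "i div b = j div b" "i mod b = j mod b"
    using that by (metis mult_div_mod_eq)
  then show "(1\<^sub>m a \<otimes>\<^sub>K 1\<^sub>m b) $$ (i, j) = (1\<^sub>m (a * b) :: 'a mat) $$ (i, j)"
    using i j div_mod_bounds[OF i] div_mod_bounds[OF j] by (auto simp: index_kron)
qed auto

lemma transpose_kron: "(A \<otimes>\<^sub>K B)\<^sup>T = A\<^sup>T \<otimes>\<^sub>K B\<^sup>T"
  by (rule eq_matI) (auto simp: index_kron div_mod_bounds)

lemma kron_pow_carrier [simp]: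
  assumes "A \<in> carrier_mat a b"
  shows "kron_pow A k \<in> carrier_mat (a ^ k) (b ^ k)"
  using assms by (induction k) auto

lemma dim_kron_pow [simp]:
  "dim_row (kron_pow A k) = dim_row A ^ k" "dim_col (kron_pow A k) = dim_col A ^ k"
  by (induction k) auto

lemma kron_pow_Suc_right: "kron_pow A (Suc k) = kron_pow A k \<otimes>\<^sub>K A"
  by (induction k) (simp_all add: kron_assoc[symmetric])

lemma kron_pow_one: "kron_pow (1\<^sub>m n) k = 1\<^sub>m (n ^ k)"
  by (induction k) (auto simp: kron_one_one)

lemma transpose_kron_pow: "(kron_pow A k)\<^sup>T = kron_pow A\<^sup>T k"
  by (induction k) (auto simp: transpose_kron)

lemma kron_pow_mult:
  fixes A B :: "'a :: comm_semiring_1 mat"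
  assumes "A \<in> carrier_mat a b" "B \<in> carrier_mat b c"
  shows "kron_pow (A * B) k = kron_pow A k * kron_pow B k"
  by (induction k) (use assms in \<open>auto simp: kron_mult[OF assms kron_pow_carrier kron_pow_carrier]\<close>)

section \<open>Ranges of block rows\<close>

lemma mat_of_cols_append_mult_vec:
  fixes u v :: "'a :: comm_semiring_1 vec"
  assumes "u \<in> carrier_vec (length us)" "v \<in> carrier_vec (length vs)"
  shows "mat_of_cols n (us @ vs) *\<^sub>v (u @\<^sub>v v) = mat_of_cols n us *\<^sub>v u + mat_of_cols n vs *\<^sub>v v"
proof (rule eq_vecI)
  fix i
  assume "i < dim_vec (mat_of_cols n us *\<^sub>v u + mat_of_cols n vs *\<^sub>v v)"
  then have i: "i < n"
    by simp
  have row: "row (mat_of_cols n (us @ vs)) i = row (mat_of_cols n us) i @\<^sub>v row (mat_of_cols n vs) i"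
    using i by (intro eq_vecI) (auto simp: mat_of_cols_index nth_append)
  show "(mat_of_cols n (us @ vs) *\<^sub>v (u @\<^sub>v v)) $ i =
      (mat_of_cols n us *\<^sub>v u + mat_of_cols n vs *\<^sub>v v) $ i"
    using i assms by (simp add: row scalar_prod_append[of _ "length us" _ "length vs"] row_carrier_vec)
qed simp

lemma mult_mat_zero_vec:
  fixes A :: "'a :: comm_semiring_1 mat"
  assumes "A \<in> carrier_mat a b"
  shows "A *\<^sub>v 0\<^sub>v b = 0\<^sub>v a"
  by (rule eq_vecI) (use assms in auto)

lemma mult_vec_in_range_concat_cols:
  fixes F :: "'b \<Rightarrow> 'a :: comm_semiring_1 mat"
  assumes "t \<in> set ts" "dim_row (F t) = n" "y \<in> carrier_vec (dim_col (F t))"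
  shows "\<exists>\<Omega> \<in> carrier_vec (length (concat (map (\<lambda>t. cols (F t)) ts))).
    mat_of_cols n (concat (map (\<lambda>t. cols (F t)) ts)) *\<^sub>v \<Omega> = F t *\<^sub>v y"
  using assms(1)
proof (induction ts)
  case (Cons s ts)
  let ?us = "cols (F s)" and ?vs = "concat (map (\<lambda>t. cols (F t)) ts)"
  have Fy: "F t *\<^sub>v y \<in> carrier_vec n"
    using assms(2) by (auto intro!: carrier_vecI)
  consider "s = t" | "t \<in> set ts"
    using Cons.prems by auto
  then show ?case
  proof cases
    case 1
    have "mat_of_cols n (?us @ ?vs) *\<^sub>v (y @\<^sub>v 0\<^sub>v (length ?vs)) =
        mat_of_cols n ?us *\<^sub>v y + mat_of_cols n ?vs *\<^sub>v 0\<^sub>v (length ?vs)"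
      by (rule mat_of_cols_append_mult_vec) (use 1 assms in auto)
    also have "mat_of_cols n ?us = F t"
      using 1 assms(2) mat_of_cols_cols[of "F t"] by simp
    finally have "mat_of_cols n (?us @ ?vs) *\<^sub>v (y @\<^sub>v 0\<^sub>v (length ?vs)) = F t *\<^sub>v y"
      using Fy by (simp only: mult_mat_zero_vec[OF mat_of_cols_carrier(1)] right_zero_vec)
    moreover have "y @\<^sub>v 0\<^sub>v (length ?vs) \<in> carrier_vec (length (?us @ ?vs))"
      using 1 assms(3) by simp
    ultimately show ?thesis
      by auto
  next
    case 2
    then obtain \<Omega> where \<Omega>: "\<Omega> \<in> carrier_vec (length ?vs)" "mat_of_cols n ?vs *\<^sub>v \<Omega> = F t *\<^sub>v y"
      using Cons.IH by blast
    have "mat_of_cols n (?us @ ?vs) *\<^sub>v (0\<^sub>v (length ?us) @\<^sub>v \<Omega>) =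
        mat_of_cols n ?us *\<^sub>v 0\<^sub>v (length ?us) + mat_of_cols n ?vs *\<^sub>v \<Omega>"
      by (rule mat_of_cols_append_mult_vec) (use \<Omega> in auto)
    then have "mat_of_cols n (?us @ ?vs) *\<^sub>v (0\<^sub>v (length ?us) @\<^sub>v \<Omega>) = F t *\<^sub>v y"
      using Fy \<Omega>(2) by (simp only: mult_mat_zero_vec[OF mat_of_cols_carrier(1)] left_zero_vec)
    moreover have "0\<^sub>v (length ?us) @\<^sub>v \<Omega> \<in> carrier_vec (length (?us @ ?vs))"
      using \<Omega>(1) by simp
    ultimately show ?thesis
      by auto
  qed
qed simp

lemma transpose_concat_cols_mult_vec_eq_0_iff:
  fixes F :: "'b \<Rightarrow> 'a :: comm_semiring_1 mat"
  assumes "\<And>t. t \<in> set ts \<Longrightarrow> dim_row (F t) = n" "w \<in> carrier_vec n"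
  defines "vs \<equiv> concat (map (\<lambda>t. cols (F t)) ts)"
  shows "(mat_of_cols n vs)\<^sup>T *\<^sub>v w = 0\<^sub>v (length vs) \<longleftrightarrow>
    (\<forall>t \<in> set ts. (F t)\<^sup>T *\<^sub>v w = 0\<^sub>v (dim_col (F t)))"
proof -
  have "set vs \<subseteq> carrier_vec n"
    unfolding vs_def using assms(1) by (auto simp: cols_def intro!: carrier_vecI)
  then have "(mat_of_cols n vs)\<^sup>T *\<^sub>v w = 0\<^sub>v (length vs) \<longleftrightarrow> (\<forall>i < length vs. (vs ! i) \<bullet> w = 0)"
    by (auto simp: vec_eq_iff) (metis col_mat_of_cols nth_mem subsetD)+
  also have "\<dots> \<longleftrightarrow> (\<forall>v \<in> set vs. v \<bullet> w = 0)"
    by (auto simp: all_set_conv_all_nth)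
  also have "\<dots> \<longleftrightarrow> (\<forall>t \<in> set ts. \<forall>j < dim_col (F t). col (F t) j \<bullet> w = 0)"
    by (force simp: vs_def cols_def)
  also have "\<dots> \<longleftrightarrow> (\<forall>t \<in> set ts. (F t)\<^sup>T *\<^sub>v w = 0\<^sub>v (dim_col (F t)))"
    by (simp add: vec_eq_iff)
  finally show ?thesis .
qed

text \<open>
  The blocks of \<open>block_row k B A\<close>, with \<open>t\<close> counted from \<open>0\<close>. The trailing Kronecker
  power of the identity is written as a single identity matrix.
\<close>
definition block :: "nat \<Rightarrow> real mat \<Rightarrow> real mat \<Rightarrow> nat \<Rightarrow> real mat" where
  "block k B A t = kron_pow B t \<otimes>\<^sub>K A \<otimes>\<^sub>K 1\<^sub>m (dim_row A ^ (k - 1 - t))"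

lemma block_row_blocks:
  "block_row k B A = mat_of_cols (dim_row A ^ k) (concat (map (\<lambda>t. cols (block k B A t)) [0..<k]))"
  by (simp add: block_row_def block_def kron_pow_one)

lemma pow_split:
  assumes "t < k"
  shows "(n :: nat) ^ t * n * n ^ (k - 1 - t) = n ^ k"
proof -
  have "k = t + 1 + (k - 1 - t)"
    using assms by simp
  then show ?thesis
    by (metis power_add power_one_right)
qed

lemma block_carrier:
  assumes "t < k" "B \<in> carrier_mat n q" "A \<in> carrier_mat n r"
  shows "block k B A t \<in> carrier_mat (n ^ k) (q ^ t * r * n ^ (k - 1 - t))"
  using kron_carrier[OF kron_carrier[OF kron_pow_carrier[OF assms(2), of t] assms(3)]
      one_carrier_mat[of "n ^ (k - 1 - t)"]] assms(3)
  unfolding pow_split[OF assms(1)] block_def by simp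

lemma block_row_carrier:
  assumes "A \<in> carrier_mat n r"
  shows "block_row k B A \<in> carrier_mat (n ^ k) (dim_col (block_row k B A))"
  using assms by (auto simp: block_row_def)

lemma block_mult_vec_in_range:
  assumes "t < k" "B \<in> carrier_mat n q" "A \<in> carrier_mat n r"
    and "y \<in> carrier_vec (dim_col (block k B A t))"
  shows "\<exists>\<Omega> \<in> carrier_vec (dim_col (block_row k B A)). block_row k B A *\<^sub>v \<Omega> = block k B A t *\<^sub>v y"
  using mult_vec_in_range_concat_cols[of t "[0..<k]" "block k B A" "n ^ k" y]
    block_carrier[OF assms(1-3)] assms by (auto simp: block_row_blocks)

lemma transpose_block_row_mult_vec_eq_0_iff:
  assumes "B \<in> carrier_mat n q" "A \<in> carrier_mat n r" "w \<in> carrier_vec (n ^ k)"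
  shows "(block_row k B A)\<^sup>T *\<^sub>v w = 0\<^sub>v (dim_col (block_row k B A)) \<longleftrightarrow>
    (\<forall>t < k. (block k B A t)\<^sup>T *\<^sub>v w = 0\<^sub>v (dim_col (block k B A t)))"
  using transpose_concat_cols_mult_vec_eq_0_iff[of "[0..<k]" "block k B A" "n ^ k" w]
    block_carrier[OF _ assms(1,2)] assms by (fastforce simp: block_row_blocks)

section \<open>The telescoping resolution of the identity\<close>

text \<open>
  Inserting \<open>1 = A * X + B * Y\<close> in the factor at position \<open>j\<close> of
  \<open>kron_pow (B * Y) j \<otimes>\<^sub>K 1\<close> splits off the \<open>j\<close>-th block as a left factor and advances
  the power of \<open>B * Y\<close> by one. Starting at \<open>j = 0\<close> this resolves the identity on the
  tensor power into the blocks and the remainder \<open>kron_pow (B * Y) k\<close>; the transposed identity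
  does the same for the kernel of the transposed block row.
\<close>
lemma telescoping_step:
  assumes "j < k" and B: "B \<in> carrier_mat n q" and Y: "Y \<in> carrier_mat q n"
    and A: "A \<in> carrier_mat n r" and X: "X \<in> carrier_mat r n" and one: "A * X + B * Y = 1\<^sub>m n"
  shows "kron_pow (B * Y) j \<otimes>\<^sub>K 1\<^sub>m (n ^ (k - j)) =
    block k B A j * (kron_pow Y j \<otimes>\<^sub>K X \<otimes>\<^sub>K 1\<^sub>m (n ^ (k - 1 - j))) +
    kron_pow (B * Y) (Suc j) \<otimes>\<^sub>K 1\<^sub>m (n ^ (k - Suc j))"
proof -
  let ?P = "kron_pow (B * Y) j" and ?I = "1\<^sub>m (n ^ (k - 1 - j)) :: real mat"
  have "n * n ^ (k - 1 - j) = n ^ (k - j)"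
    using assms(1) by (metis Suc_diff_Suc diff_Suc_eq_diff_pred power_Suc)
  then have "?P \<otimes>\<^sub>K 1\<^sub>m (n ^ (k - j)) = ?P \<otimes>\<^sub>K 1\<^sub>m n \<otimes>\<^sub>K ?I"
    by (simp add: kron_assoc kron_one_one)
  also have "\<dots> = ?P \<otimes>\<^sub>K (A * X) \<otimes>\<^sub>K ?I + ?P \<otimes>\<^sub>K (B * Y) \<otimes>\<^sub>K ?I"
  proof -
    have "?P \<otimes>\<^sub>K (A * X) \<in> carrier_mat (n ^ j * n) (n ^ j * n)"
      "?P \<otimes>\<^sub>K (B * Y) \<in> carrier_mat (n ^ j * n) (n ^ j * n)"
      using A X B Y by auto
    then show ?thesis
      using A X B Y by (simp only: one[symmetric] kron_add_right[of _ n n] mult_carrier_mat kron_add_left)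
  qed
  also have "?P \<otimes>\<^sub>K (B * Y) = kron_pow (B * Y) (Suc j)"
    by (simp add: kron_pow_Suc_right del: kron_pow.simps)
  also have "?P \<otimes>\<^sub>K (A * X) \<otimes>\<^sub>K ?I = block k B A j * (kron_pow Y j \<otimes>\<^sub>K X \<otimes>\<^sub>K ?I)"
  proof -
    note mult = kron_mult[OF kron_pow_carrier[OF B] kron_pow_carrier[OF Y] A X, of j]
    have "block k B A j * (kron_pow Y j \<otimes>\<^sub>K X \<otimes>\<^sub>K ?I) =
        ((kron_pow B j \<otimes>\<^sub>K A) * (kron_pow Y j \<otimes>\<^sub>K X)) \<otimes>\<^sub>K (?I * ?I)"
      using A kron_mult[OF kron_carrier[OF kron_pow_carrier[OF B] A]
          kron_carrier[OF kron_pow_carrier[OF Y] X] one_carrier_mat one_carrier_mat,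
          of j "n ^ (k - 1 - j)"]
      by (simp add: block_def)
    then show ?thesis
      by (simp add: mult kron_pow_mult[OF B Y])
  qed
  finally show ?thesis
    by (simp del: kron_pow.simps)
qed

lemma telescoping_factor_carrier:
  assumes "j < k" "Y \<in> carrier_mat q n" "X \<in> carrier_mat r n"
  shows "kron_pow Y j \<otimes>\<^sub>K X \<otimes>\<^sub>K 1\<^sub>m (n ^ (k - 1 - j))
    \<in> carrier_mat (q ^ j * r * n ^ (k - 1 - j)) (n ^ k)"
  using kron_carrier[OF kron_carrier[OF kron_pow_carrier[OF assms(2), of j] assms(3)]
      one_carrier_mat[of "n ^ (k - 1 - j)"]]
  unfolding pow_split[OF assms(1)] .

lemma telescoping_remainder_carrier:
  assumes "j \<le> k" "D \<in> carrier_mat n n"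
  shows "kron_pow D j \<otimes>\<^sub>K 1\<^sub>m (n ^ (k - j)) \<in> carrier_mat (n ^ k) (n ^ k)"
  using kron_carrier[OF kron_pow_carrier[OF assms(2), of j] one_carrier_mat[of "n ^ (k - j)"]]
    assms(1) by (simp add: power_add[symmetric] del: kron_carrier)

lemma block_row_range_decomposition:
  assumes B: "B \<in> carrier_mat n q" and Y: "Y \<in> carrier_mat q n"
    and A: "A \<in> carrier_mat n r" and X: "X \<in> carrier_mat r n" and one: "A * X + B * Y = 1\<^sub>m n"
    and z: "z \<in> carrier_vec (n ^ k)"
  shows "\<exists>\<Omega> \<in> carrier_vec (dim_col (block_row k B A)).
    block_row k B A *\<^sub>v \<Omega> + kron_pow (B * Y) k *\<^sub>v z = z"
proof -
  let ?M = "block_row k B A"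
  note M = block_row_carrier[OF A, of k B]
  have "\<exists>\<Omega> \<in> carrier_vec (dim_col ?M).
      ?M *\<^sub>v \<Omega> + (kron_pow (B * Y) j \<otimes>\<^sub>K 1\<^sub>m (n ^ (k - j))) *\<^sub>v z = z" if "j \<le> k" for j
    using that
  proof (induction j)
    case 0
    have "?M *\<^sub>v 0\<^sub>v (dim_col ?M) + (kron_pow (B * Y) 0 \<otimes>\<^sub>K 1\<^sub>m (n ^ (k - 0))) *\<^sub>v z = z"
      using z by (simp add: mult_mat_zero_vec[OF M])
    then show ?case
      by (rule bexI[OF _ zero_carrier_vec])
  next
    case (Suc j)
    let ?T = "kron_pow Y j \<otimes>\<^sub>K X \<otimes>\<^sub>K 1\<^sub>m (n ^ (k - 1 - j))"
    let ?R = "kron_pow (B * Y) (Suc j) \<otimes>\<^sub>K 1\<^sub>m (n ^ (k - Suc j))"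
    obtain \<Omega> where \<Omega>: "\<Omega> \<in> carrier_vec (dim_col ?M)"
      "?M *\<^sub>v \<Omega> + (kron_pow (B * Y) j \<otimes>\<^sub>K 1\<^sub>m (n ^ (k - j))) *\<^sub>v z = z"
      using Suc.IH[OF Suc_leD[OF Suc.prems]] by blast
    have j: "j < k"
      using Suc.prems by simp
    note blk = block_carrier[OF j B A]
    note T = telescoping_factor_carrier[OF j Y X]
      and R = telescoping_remainder_carrier[OF Suc.prems mult_carrier_mat[OF B Y]]
    have Tz: "?T *\<^sub>v z \<in> carrier_vec (dim_col (block k B A j))"
      using T z blk by auto
    obtain \<Omega>' where \<Omega>': "\<Omega>' \<in> carrier_vec (dim_col ?M)"
      "?M *\<^sub>v \<Omega>' = block k B A j *\<^sub>v (?T *\<^sub>v z)"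
      using block_mult_vec_in_range[OF j B A Tz] by blast
    have "(kron_pow (B * Y) j \<otimes>\<^sub>K 1\<^sub>m (n ^ (k - j))) *\<^sub>v z = block k B A j *\<^sub>v (?T *\<^sub>v z) + ?R *\<^sub>v z"
      unfolding telescoping_step[OF j B Y A X one]
        add_mult_distrib_mat_vec[OF mult_carrier_mat[OF blk T] R z]
        assoc_mult_mat_vec[OF blk T z] ..
    then have "?M *\<^sub>v (\<Omega> + \<Omega>') + ?R *\<^sub>v z = z"
      using \<Omega>(2) assoc_add_vec[OF mult_mat_vec_carrier[OF M \<Omega>(1)]
          mult_mat_vec_carrier[OF M \<Omega>'(1)] mult_mat_vec_carrier[OF R z]]
      by (simp only: mult_add_distrib_mat_vec[OF M \<Omega>(1) \<Omega>'(1)] \<Omega>'(2))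
    moreover have "\<Omega> + \<Omega>' \<in> carrier_vec (dim_col ?M)"
      using \<Omega>(1) \<Omega>'(1) by simp
    ultimately show ?case
      by (rule bexI)
  qed
  from this[OF order_refl] show ?thesis
    unfolding diff_self_eq_0 power_0 One_nat_def kron_one_right .
qed

lemma transpose_block_row_kernel:
  assumes B: "B \<in> carrier_mat n q" and Y: "Y \<in> carrier_mat q n"
    and A: "A \<in> carrier_mat n r" and X: "X \<in> carrier_mat r n" and one: "A * X + B * Y = 1\<^sub>m n"
    and w: "w \<in> carrier_vec (n ^ k)"
    and ker: "(block_row k B A)\<^sup>T *\<^sub>v w = 0\<^sub>v (dim_col (block_row k B A))"
  shows "(kron_pow (B * Y) k)\<^sup>T *\<^sub>v w = w"
proof -
  have "(kron_pow (B * Y) j \<otimes>\<^sub>K 1\<^sub>m (n ^ (k - j)))\<^sup>T *\<^sub>v w = w" if "j \<le> k" for j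
    using that
  proof (induction j)
    case 0
    then show ?case
      using w by simp
  next
    case (Suc j)
    let ?T = "kron_pow Y j \<otimes>\<^sub>K X \<otimes>\<^sub>K 1\<^sub>m (n ^ (k - 1 - j))"
    let ?R = "kron_pow (B * Y) (Suc j) \<otimes>\<^sub>K 1\<^sub>m (n ^ (k - Suc j))"
    have j: "j < k"
      using Suc.prems by simp
    note blk = block_carrier[OF j B A]
    note T = telescoping_factor_carrier[OF j Y X]
      and R = telescoping_remainder_carrier[OF Suc.prems mult_carrier_mat[OF B Y]]
    have "(block k B A j)\<^sup>T *\<^sub>v w = 0\<^sub>v (dim_col (block k B A j))"
      using ker j transpose_block_row_mult_vec_eq_0_iff[OF B A w] by blast
    then have "(block k B A j)\<^sup>T *\<^sub>v w = 0\<^sub>v (q ^ j * r * n ^ (k - 1 - j))"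
      using blk by (simp only: carrier_matD(2))
    then have "(block k B A j * ?T)\<^sup>T *\<^sub>v w = 0\<^sub>v (n ^ k)"
      unfolding transpose_mult[OF blk T]
        assoc_mult_mat_vec[OF transpose_carrier_mat[THEN iffD2, OF T] transpose_carrier_mat[THEN iffD2, OF blk] w]
      by (simp only: mult_mat_zero_vec[OF transpose_carrier_mat[THEN iffD2, OF T]])
    moreover have "(block k B A j * ?T + ?R)\<^sup>T *\<^sub>v w = (block k B A j * ?T)\<^sup>T *\<^sub>v w + ?R\<^sup>T *\<^sub>v w"
      using add_mult_distrib_mat_vec[of "(block k B A j * ?T)\<^sup>T" "n ^ k" "n ^ k" "?R\<^sup>T" w]
        mult_carrier_mat[OF blk T] R w
      by (simp only: transpose_add[of _ "n ^ k" "n ^ k"] transpose_carrier_mat)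
    moreover have "(block k B A j * ?T + ?R)\<^sup>T *\<^sub>v w = w"
      using Suc.IH[OF Suc_leD[OF Suc.prems]] unfolding telescoping_step[OF j B Y A X one] .
    ultimately show ?case
      by (simp only: left_zero_vec[OF mult_mat_vec_carrier[OF transpose_carrier_mat[THEN iffD2, OF R] w]])
  qed
  from this[OF order_refl] show ?thesis
    unfolding diff_self_eq_0 power_0 One_nat_def kron_one_right .
qed

section \<open>Range and cokernel of the block row\<close>

lemma kron_pow_add: "kron_pow A (i + j) = kron_pow A i \<otimes>\<^sub>K kron_pow A j"
  by (induction i) (simp_all add: kron_assoc)

text \<open>
  The matrix \<open>T\<close> at position \<open>t\<close> of the Kronecker power meets the factor \<open>A\<close> of the block.
\<close>
lemma kron_pow_mult_block_eq_0:
  assumes "t < k" and T: "T \<in> carrier_mat q n" and A: "A \<in> carrier_mat n r" and B: "B \<in> carrier_mat n p"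
    and ann: "T * A = 0\<^sub>m q r"
  shows "kron_pow T k * block k B A t = 0\<^sub>m (q ^ k) (dim_col (block k B A t))"
proof -
  let ?s = "k - 1 - t" and ?I = "1\<^sub>m (n ^ (k - 1 - t)) :: real mat"
  have "kron_pow T k = kron_pow T t \<otimes>\<^sub>K T \<otimes>\<^sub>K kron_pow T ?s"
    using kron_pow_add[of T "Suc t" ?s] assms(1) unfolding kron_pow_Suc_right by simp
  then have "kron_pow T k * block k B A t =
      (kron_pow T t \<otimes>\<^sub>K T \<otimes>\<^sub>K kron_pow T ?s) * (kron_pow B t \<otimes>\<^sub>K A \<otimes>\<^sub>K ?I)"
    using A by (simp add: block_def)
  also have "\<dots> = ((kron_pow T t \<otimes>\<^sub>K T) * (kron_pow B t \<otimes>\<^sub>K A)) \<otimes>\<^sub>K (kron_pow T ?s * ?I)"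
    by (rule kron_mult[OF kron_carrier[OF kron_pow_carrier[OF T] T]
          kron_carrier[OF kron_pow_carrier[OF B] A] kron_pow_carrier[OF T] one_carrier_mat])
  also have "(kron_pow T t \<otimes>\<^sub>K T) * (kron_pow B t \<otimes>\<^sub>K A) = (kron_pow T t * kron_pow B t) \<otimes>\<^sub>K (T * A)"
    by (rule kron_mult[OF kron_pow_carrier[OF T] kron_pow_carrier[OF B] T A])
  also have "\<dots> = 0\<^sub>m (q ^ t * q) (p ^ t * r)"
    unfolding ann
    by (rule kron_zero_right[OF mult_carrier_mat[OF kron_pow_carrier[OF T] kron_pow_carrier[OF B]]])
  also have "0\<^sub>m (q ^ t * q) (p ^ t * r) \<otimes>\<^sub>K (kron_pow T ?s * ?I) =
      0\<^sub>m (q ^ t * q * q ^ ?s) (p ^ t * r * n ^ ?s)"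
    by (rule kron_zero_left[OF mult_carrier_mat[OF kron_pow_carrier[OF T] one_carrier_mat]])
  also have "\<dots> = 0\<^sub>m (q ^ k) (dim_col (block k B A t))"
    using block_carrier[OF assms(1) B A] pow_split[OF assms(1)] by simp
  finally show ?thesis .
qed

lemma transpose_block_row_mult_kron_pow:
  assumes Th: "\<Theta> \<in> carrier_mat n q" and A: "A \<in> carrier_mat n r" and B: "B \<in> carrier_mat n p"
    and ann: "\<Theta>\<^sup>T * A = 0\<^sub>m q r"
  shows "(block_row k B A)\<^sup>T * kron_pow \<Theta> k = 0\<^sub>m (dim_col (block_row k B A)) (q ^ k)"
proof (rule eq_matI)
  fix i j
  assume "i < dim_row (0\<^sub>m (dim_col (block_row k B A)) (q ^ k) :: real mat)"
    and "j < dim_col (0\<^sub>m (dim_col (block_row k B A)) (q ^ k) :: real mat)"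
  then have i: "i < dim_col (block_row k B A)" and j: "j < q ^ k"
    by auto
  let ?c = "col (kron_pow \<Theta> k) j"
  have c: "?c \<in> carrier_vec (n ^ k)"
    using Th j by (auto intro!: carrier_vecI)
  have "(block k B A t)\<^sup>T *\<^sub>v ?c = 0\<^sub>v (dim_col (block k B A t))" if t: "t < k" for t
  proof -
    note blk = block_carrier[OF t B A]
    have "(block k B A t)\<^sup>T * kron_pow \<Theta> k = ((kron_pow \<Theta> k)\<^sup>T * block k B A t)\<^sup>T"
      using transpose_mult[OF _ blk, of "(kron_pow \<Theta> k)\<^sup>T" "q ^ k"] Th by simp
    also have "\<dots> = 0\<^sub>m (dim_col (block k B A t)) (q ^ k)"
      using kron_pow_mult_block_eq_0[OF t _ A B ann] Th by (simp add: transpose_kron_pow)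
    finally have "col ((block k B A t)\<^sup>T * kron_pow \<Theta> k) j = 0\<^sub>v (dim_col (block k B A t))"
      using j by simp
    then show ?thesis
      using col_mult2[of "(block k B A t)\<^sup>T" _ "n ^ k" "kron_pow \<Theta> k" "q ^ k" j] blk Th j by auto
  qed
  then have "(block_row k B A)\<^sup>T *\<^sub>v ?c = 0\<^sub>v (dim_col (block_row k B A))"
    using transpose_block_row_mult_vec_eq_0_iff[OF B A c] by blast
  then have "((block_row k B A)\<^sup>T *\<^sub>v ?c) $ i = 0"
    using i by simp
  then show "((block_row k B A)\<^sup>T * kron_pow \<Theta> k) $$ (i, j) =
      0\<^sub>m (dim_col (block_row k B A)) (q ^ k) $$ (i, j)"
    using i j Th by simp
qed (use Th in auto)

text \<open>
  The remainder of the telescoping, \<open>kron_pow (B * R * \<Theta>\<^sup>T) k\<close>, has the right factor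
  \<open>(kron_pow \<Theta> k)\<^sup>T\<close>. Hence its transpose has range inside that of \<open>kron_pow \<Theta> k\<close>, and
  it kills every vector annihilated by \<open>(kron_pow \<Theta> k)\<^sup>T\<close>. The former gives this
  lemma, the latter the next one.
\<close>
lemma transpose_block_row_kernel_subset:
  assumes Th: "\<Theta> \<in> carrier_mat n q" and A: "A \<in> carrier_mat n r" and B: "B \<in> carrier_mat n p"
    and X: "X \<in> carrier_mat r n" and R: "R \<in> carrier_mat p q"
    and one: "A * X + B * (R * \<Theta>\<^sup>T) = 1\<^sub>m n"
    and w: "w \<in> carrier_vec (n ^ k)"
    and ker: "(block_row k B A)\<^sup>T *\<^sub>v w = 0\<^sub>v (dim_col (block_row k B A))"
  shows "\<exists>u \<in> carrier_vec (q ^ k). w = kron_pow \<Theta> k *\<^sub>v u"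
proof -
  have Tt: "\<Theta>\<^sup>T \<in> carrier_mat q n" and BR: "B * R \<in> carrier_mat n q"
    using Th B R by auto
  have "kron_pow (B * (R * \<Theta>\<^sup>T)) k = kron_pow (B * R) k * kron_pow \<Theta>\<^sup>T k"
    unfolding assoc_mult_mat[OF B R Tt, symmetric] by (rule kron_pow_mult[OF BR Tt])
  then have "(kron_pow (B * (R * \<Theta>\<^sup>T)) k)\<^sup>T = kron_pow \<Theta> k * (kron_pow (B * R) k)\<^sup>T"
    using transpose_mult[OF kron_pow_carrier[OF BR] kron_pow_carrier[OF Tt]]
    by (simp add: transpose_kron_pow)
  moreover have "(kron_pow (B * (R * \<Theta>\<^sup>T)) k)\<^sup>T *\<^sub>v w = w"
    by (rule transpose_block_row_kernel[OF B mult_carrier_mat[OF R Tt] A X one w ker])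
  moreover have C: "(kron_pow (B * R) k)\<^sup>T \<in> carrier_mat (q ^ k) (n ^ k)"
    using kron_pow_carrier[OF BR] by simp
  ultimately have "kron_pow \<Theta> k *\<^sub>v ((kron_pow (B * R) k)\<^sup>T *\<^sub>v w) = w"
    using assoc_mult_mat_vec[OF kron_pow_carrier[OF Th] C w] by simp
  then show ?thesis
    by (intro bexI[OF _ mult_mat_vec_carrier[OF C w]]) (rule sym)
qed

lemma kron_pow_annihilator_subset_block_row_range:
  assumes Th: "\<Theta> \<in> carrier_mat n q" and A: "A \<in> carrier_mat n r" and B: "B \<in> carrier_mat n p"
    and X: "X \<in> carrier_mat r n" and R: "R \<in> carrier_mat p q"
    and one: "A * X + B * (R * \<Theta>\<^sup>T) = 1\<^sub>m n"
    and z: "z \<in> carrier_vec (n ^ k)" and ann: "(kron_pow \<Theta> k)\<^sup>T *\<^sub>v z = 0\<^sub>v (q ^ k)"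
  shows "\<exists>\<Omega> \<in> carrier_vec (dim_col (block_row k B A)). block_row k B A *\<^sub>v \<Omega> = z"
proof -
  have Tt: "\<Theta>\<^sup>T \<in> carrier_mat q n" and BR: "B * R \<in> carrier_mat n q"
    using Th B R by auto
  have "kron_pow (B * (R * \<Theta>\<^sup>T)) k = kron_pow (B * R) k * kron_pow \<Theta>\<^sup>T k"
    unfolding assoc_mult_mat[OF B R Tt, symmetric] by (rule kron_pow_mult[OF BR Tt])
  then have "kron_pow (B * (R * \<Theta>\<^sup>T)) k *\<^sub>v z = 0\<^sub>v (n ^ k)"
    using assoc_mult_mat_vec[OF kron_pow_carrier[OF BR] kron_pow_carrier[OF Tt] z] ann
      mult_mat_zero_vec[OF kron_pow_carrier[OF BR]]
    by (simp add: transpose_kron_pow)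
  then obtain \<Omega> where \<Omega>: "\<Omega> \<in> carrier_vec (dim_col (block_row k B A))"
      "block_row k B A *\<^sub>v \<Omega> + 0\<^sub>v (n ^ k) = z"
    using block_row_range_decomposition[OF B mult_carrier_mat[OF R Tt] A X one z] by auto
  then show ?thesis
    using right_zero_vec[OF mult_mat_vec_carrier[OF block_row_carrier[OF A] \<Omega>(1)]] by auto
qed

section \<open>Complementary selections\<close>

lemma mat_inv:
  fixes A :: "'a :: field mat"
  assumes A: "A \<in> carrier_mat n n" and inv: "invertible_mat A"
  shows "mat_inv A \<in> carrier_mat n n" "A * mat_inv A = 1\<^sub>m n" "mat_inv A * A = 1\<^sub>m n"
proof -
  obtain B where B: "A * B = 1\<^sub>m n" "B * A = 1\<^sub>m (dim_row B)"
    using inv A by (auto simp: invertible_mat_def inverts_mat_def)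
  then have "B \<in> carrier_mat n n"
    using A index_mult_mat(3)[of A B, unfolded B(1)] index_mult_mat(3)[of B A, unfolded B(2)]
    by (intro carrier_matI) simp_all
  then have "A \<in> Units (ring_mat TYPE('a) n n)"
    using A B by (auto simp: Units_def ring_mat_def)
  then obtain C where C: "mat_inverse A = Some C"
    using mat_inverse(1)[OF A, where b = n] by (cases "mat_inverse A") auto
  then show "mat_inv A \<in> carrier_mat n n" "A * mat_inv A = 1\<^sub>m n" "mat_inv A * A = 1\<^sub>m n"
    using mat_inverse(2)[OF A C] by (auto simp: mat_inv_def)
qed

lemma mat_of_cols_map_carrier: "mat_of_cols n (map f js) \<in> carrier_mat n (length js)"
  using mat_of_cols_carrier(1)[of n "map f js"] by simp

lemma selection_mult_transpose:
  assumes "distinct js" "set js \<subseteq> {..<n}"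
  shows "mat_of_cols n (map (unit_vec n) js) * (mat_of_cols n (map (unit_vec n) js))\<^sup>T =
    mat n n (\<lambda>(i, j). if i = j \<and> i \<in> set js then 1 else 0 :: real)"
proof (rule eq_matI)
  fix i j
  assume "i < dim_row (mat n n (\<lambda>(i, j). if i = j \<and> i \<in> set js then 1 else 0 :: real))"
    and "j < dim_col (mat n n (\<lambda>(i, j). if i = j \<and> i \<in> set js then 1 else 0 :: real))"
  then have i: "i < n" and j: "j < n"
    by auto
  let ?S = "mat_of_cols n (map (unit_vec n) js) :: real mat"
  have lt: "js ! l < n" if "l < length js" for l
    using assms(2) that nth_mem by blast
  have "(?S * ?S\<^sup>T) $$ (i, j) =
      (\<Sum>l<length js. (if js ! l = i then 1 else 0) * (if js ! l = j then 1 else 0))"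
    using i j lt by (auto simp: scalar_prod_def mat_of_cols_index atLeast0LessThan intro!: sum.cong)
  also have "\<dots> = (\<Sum>x\<in>set js. (if x = i then 1 else 0) * (if x = j then 1 else 0))"
    by (rule sum.reindex_bij_betw) (use bij_betw_nth[OF assms(1)] in auto)
  also have "\<dots> = (\<Sum>x\<in>set js. if x = i then (if i = j then 1 else 0) else 0)"
    by (intro sum.cong) auto
  also have "\<dots> = (if i = j \<and> i \<in> set js then 1 else 0)"
    by simp
  finally show "(?S * ?S\<^sup>T) $$ (i, j) =
      mat n n (\<lambda>(i, j). if i = j \<and> i \<in> set js then 1 else 0 :: real) $$ (i, j)"
    using i j by simp
qed auto

lemma selection_complement:
  assumes "distinct is" "distinct js" "set is \<subseteq> {..<n}" "set js = {..<n} - set is"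
  defines "S \<equiv> mat_of_cols n (map (unit_vec n) is) :: real mat"
    and "T \<equiv> mat_of_cols n (map (unit_vec n) js) :: real mat"
  shows "S * S\<^sup>T + T * T\<^sup>T = 1\<^sub>m n"
proof -
  have sub: "set js \<subseteq> {..<n}"
    using assms(4) by blast
  show ?thesis
    unfolding S_def T_def selection_mult_transpose[OF assms(1,3)]
      selection_mult_transpose[OF assms(2) sub]
  proof (rule eq_matI)
    fix i j
    assume "i < dim_row (1\<^sub>m n :: real mat)" "j < dim_col (1\<^sub>m n :: real mat)"
    moreover have "i \<in> set js \<longleftrightarrow> i < n \<and> i \<notin> set is"
      unfolding assms(4) by simp
    ultimately show "(mat n n (\<lambda>(i, j). if i = j \<and> i \<in> set is then 1 else 0) +
        mat n n (\<lambda>(i, j). if i = j \<and> i \<in> set js then 1 else 0)) $$ (i, j) =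
        (1\<^sub>m n :: real mat) $$ (i, j)"
      by simp
  qed simp_all
qed

lemma basis_columns_selection_invertible:
  assumes A: "A \<in> carrier_mat n r" and basis: "vec_space.basis_columns r A\<^sup>T J" and card: "card J = r"
  obtains "is" G where "distinct is" "set is = J" "J \<subseteq> {..<n}" "length is = r"
    "G \<in> carrier_mat r r"
    "(mat_of_cols n (map (unit_vec n) is))\<^sup>T * A * G = (1\<^sub>m r :: real mat)"
    "G * ((mat_of_cols n (map (unit_vec n) is))\<^sup>T * A) = (1\<^sub>m r :: real mat)"
proof -
  interpret vec_space "TYPE(real)" r .
  have J: "J \<subseteq> {..<n}" and inj: "inj_on (col A\<^sup>T) J" and indpt: "lin_indpt (col A\<^sup>T ` J)"
    using basis A unfolding basis_columns_def by auto
  define l where "l = sorted_list_of_set J"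
  have fin: "finite J"
    using J finite_subset by blast
  have l: "distinct l" "set l = J" "length l = r"
    using fin card by (auto simp: l_def)
  define P where "P = mat_of_cols r (map (col A\<^sup>T) l)"
  have P: "P \<in> carrier_mat r r"
    using l by (auto simp: P_def intro: mat_of_cols_carrier)
  have cols: "cols P = map (col A\<^sup>T) l"
    unfolding P_def by (rule cols_mat_of_cols) (use A in \<open>auto intro!: carrier_vecI\<close>)
  have "rank P = r"
    by (rule lin_indpt_full_rank[OF P]) (use l inj indpt in \<open>auto simp: cols distinct_map\<close>)
  then have "P \<in> Units (ring_mat TYPE(real) r r)"
    using det_rank_iff[OF P] det_non_zero_imp_unit[OF P, where b = r] by blast
  then obtain Q where Q: "Q \<in> carrier_mat r r" "P * Q = 1\<^sub>m r" "Q * P = 1\<^sub>m r"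
    by (auto simp: Units_def ring_mat_def)
  let ?S = "mat_of_cols n (map (unit_vec n) l) :: real mat"
  have lt: "l ! i < n" if "i < r" for i
    using J l that nth_mem by blast
  have "?S\<^sup>T * A = P\<^sup>T"
  proof (rule eq_matI)
    fix i j
    assume "i < dim_row P\<^sup>T" "j < dim_col P\<^sup>T"
    then have i: "i < r" and j: "j < r"
      using P by auto
    have "col ?S i = unit_vec n (l ! i)"
      using i l by (simp add: col_mat_of_cols)
    moreover have "col A j \<in> carrier_vec n"
      using A j by auto
    ultimately have "(?S\<^sup>T * A) $$ (i, j) = A $$ (l ! i, j)"
      using A i j l lt[OF i] by simp
    also have "\<dots> = P\<^sup>T $$ (i, j)"
      using A P i j l lt[OF i] by (simp add: P_def mat_of_cols_index)
    finally show "(?S\<^sup>T * A) $$ (i, j) = P\<^sup>T $$ (i, j)" .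
  qed (use P A l in auto)
  moreover have "P\<^sup>T * Q\<^sup>T = 1\<^sub>m r"
    using transpose_mult[OF Q(1) P] unfolding Q(3) transpose_one by (rule sym)
  moreover have "Q\<^sup>T * P\<^sup>T = 1\<^sub>m r"
    using transpose_mult[OF P Q(1)] unfolding Q(2) transpose_one by (rule sym)
  ultimately show ?thesis
    using Q(1) by (intro that[OF l(1,2) J l(3), of "Q\<^sup>T"]) (simp_all only: transpose_carrier_mat)
qed

lemma complement_selection_carrier:
  assumes "is_complement_selection n J S"
  shows "S \<in> carrier_mat n (dim_col S)"
proof -
  have "dim_row S = n"
    using assms unfolding is_complement_selection_def by force
  then show ?thesis
    by (rule carrier_matI) (rule refl)
qed

text \<open>
  If \<open>K\<close> selects the rows \<open>J\<close> of \<open>A\<close>, then \<open>K\<^sup>T * A\<close> is invertible, because its rows are the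
  chosen basis. With its inverse \<open>G\<close> the witnesses are \<open>X = G * K\<^sup>T\<close> and
  \<open>Y = S\<^sup>T * (1 - A * X)\<close>: the matrix \<open>1 - A * X\<close> vanishes on the range of \<open>A\<close>, and
  \<open>K\<^sup>T\<close> annihilates it, so that \<open>S * S\<^sup>T = 1 - K * K\<^sup>T\<close> fixes it.
\<close>
lemma complement_selection_resolution:
  assumes A: "A \<in> carrier_mat n r" and basis: "vec_space.basis_columns r A\<^sup>T J" and card: "card J = r"
    and S: "is_complement_selection n J S"
  obtains X Y where "X \<in> carrier_mat r n" "Y \<in> carrier_mat (dim_col S) n"
    "A * X + S * Y = 1\<^sub>m n" "Y * A = 0\<^sub>m (dim_col S) r"
proof -
  obtain js where js: "distinct js" "set js = {..<n} - J" "S = mat_of_cols n (map (unit_vec n) js)"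
    using S unfolding is_complement_selection_def by blast
  obtain l G where l: "distinct l" "set l = J" "J \<subseteq> {..<n}" "length l = r"
    and G: "G \<in> carrier_mat r r"
    and inv: "(mat_of_cols n (map (unit_vec n) l))\<^sup>T * A * G = (1\<^sub>m r :: real mat)"
      "G * ((mat_of_cols n (map (unit_vec n) l))\<^sup>T * A) = (1\<^sub>m r :: real mat)"
    using basis_columns_selection_invertible[OF A basis card] by blast
  define K where "K = (mat_of_cols n (map (unit_vec n) l) :: real mat)"
  have K: "K \<in> carrier_mat n r" and Kt: "K\<^sup>T \<in> carrier_mat r n"
    using mat_of_cols_map_carrier[of n "unit_vec n :: nat \<Rightarrow> real vec" l]
    unfolding K_def l(4) transpose_carrier_mat by this+
  define q where "q = dim_col S"
  have Sc: "S \<in> carrier_mat n q"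
    unfolding q_def by (rule complement_selection_carrier[OF S])
  then have St: "S\<^sup>T \<in> carrier_mat q n"
    by simp
  have sum: "K * K\<^sup>T + S * S\<^sup>T = 1\<^sub>m n"
    using l(2,3) js(2) unfolding K_def js(3) by (intro selection_complement[OF l(1) js(1)]) auto
  define X where "X = G * K\<^sup>T"
  have X: "X \<in> carrier_mat r n"
    using G Kt by (simp add: X_def)
  have AX: "A * X \<in> carrier_mat n n"
    using A X by simp
  have XA: "X * A = 1\<^sub>m r"
    using inv(2) assoc_mult_mat[OF G Kt A] by (simp add: X_def K_def)
  have KAX: "K\<^sup>T * (A * X) = K\<^sup>T"
  proof -
    have "K\<^sup>T * (A * X) = K\<^sup>T * A * (G * K\<^sup>T)"
      unfolding X_def[symmetric] by (rule assoc_mult_mat[symmetric, OF Kt A X])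
    also have "\<dots> = K\<^sup>T * A * G * K\<^sup>T"
      by (rule assoc_mult_mat[symmetric, OF mult_carrier_mat[OF Kt A] G Kt])
    also have "\<dots> = K\<^sup>T"
      unfolding K_def inv(1) by (rule left_mult_one_mat) (use Kt in \<open>simp add: K_def\<close>)
    finally show ?thesis .
  qed
  have D: "1\<^sub>m n - A * X \<in> carrier_mat n n"
    using AX by (rule minus_carrier_mat)
  define Y where "Y = S\<^sup>T * (1\<^sub>m n - A * X)"
  have Y: "Y \<in> carrier_mat q n"
    unfolding Y_def by (rule mult_carrier_mat[OF St D])
  have "S * Y = S * S\<^sup>T * (1\<^sub>m n - A * X)"
    unfolding Y_def by (rule assoc_mult_mat[symmetric, OF Sc St D])
  also have "S * S\<^sup>T = 1\<^sub>m n - K * K\<^sup>T"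
  proof -
    have "S * S\<^sup>T = (K * K\<^sup>T + S * S\<^sup>T) - K * K\<^sup>T"
      by (rule eq_matI) (use K Sc in auto)
    then show ?thesis
      by (simp add: sum)
  qed
  also have "(1\<^sub>m n - K * K\<^sup>T) * (1\<^sub>m n - A * X) = (1\<^sub>m n - A * X) - K * K\<^sup>T * (1\<^sub>m n - A * X)"
    using minus_mult_distrib_mat[OF one_carrier_mat mult_carrier_mat[OF K Kt] D]
    by (simp only: left_mult_one_mat[OF D])
  also have "K * K\<^sup>T * (1\<^sub>m n - A * X) = K * (K\<^sup>T * (1\<^sub>m n - A * X))"
    by (rule assoc_mult_mat[OF K Kt D])
  also have "K\<^sup>T * (1\<^sub>m n - A * X) = K\<^sup>T - K\<^sup>T"
    using mult_minus_distrib_mat[OF Kt one_carrier_mat AX]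
    by (simp only: KAX right_mult_one_mat[OF Kt])
  also have "\<dots> = 0\<^sub>m r n"
    by (rule minus_r_inv_mat[OF Kt])
  also have "K * \<dots> = 0\<^sub>m n n"
    by (rule right_mult_zero_mat[OF K])
  finally have SY: "S * Y = (1\<^sub>m n - A * X) - 0\<^sub>m n n" .
  have "C + ((1\<^sub>m n - C) - 0\<^sub>m n n) = 1\<^sub>m n" if "C \<in> carrier_mat n n" for C :: "real mat"
    by (rule eq_matI) (use that in auto)
  from this[OF AX] have "A * X + S * Y = 1\<^sub>m n"
    unfolding SY .
  moreover have "Y * A = 0\<^sub>m q r"
  proof -
    have "Y * A = S\<^sup>T * ((1\<^sub>m n - A * X) * A)"
      unfolding Y_def by (rule assoc_mult_mat[OF St D A])
    also have "(1\<^sub>m n - A * X) * A = A - A * X * A"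
      using minus_mult_distrib_mat[OF one_carrier_mat AX A] by (simp only: left_mult_one_mat[OF A])
    also have "A * X * A = A"
      unfolding assoc_mult_mat[OF A X A] XA by (rule right_mult_one_mat[OF A])
    also have "A - A = 0\<^sub>m n r"
      by (rule minus_r_inv_mat[OF A])
    also have "S\<^sup>T * \<dots> = 0\<^sub>m q r"
      by (rule right_mult_zero_mat[OF St])
    finally show ?thesis .
  qed
  ultimately show ?thesis
    using that[OF X] Y by (simp add: q_def)
qed

section \<open>The projector\<close>

text \<open>
  The projector annihilates \<open>A\<close>, and its left factor \<open>\<Theta>l\<close> has the left inverse \<open>\<Theta>r\<^sup>T\<close>.
\<close>
lemma projector_factor_annihilates:
  fixes A F H :: "real mat"
  assumes A: "A \<in> carrier_mat n r" and F: "F \<in> carrier_mat n n" and H: "H \<in> carrier_mat r r"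
    and inv: "H * (A\<^sup>T * F * A) = 1\<^sub>m r"
    and L: "\<Theta>l \<in> carrier_mat n q" and R: "\<Theta>r \<in> carrier_mat n q"
    and proj: "1\<^sub>m n - A * H * A\<^sup>T * F = \<Theta>l * \<Theta>r\<^sup>T" and biorth: "\<Theta>l\<^sup>T * \<Theta>r = 1\<^sub>m q"
  shows "\<Theta>r\<^sup>T * A = 0\<^sub>m q r"
proof -
  have At: "A\<^sup>T \<in> carrier_mat r n" and Rt: "\<Theta>r\<^sup>T \<in> carrier_mat q n"
    using A R by auto
  have "A * H * A\<^sup>T * F * A = A * (H * (A\<^sup>T * F * A))"
    using A At F H by (simp add: assoc_mult_mat[of _ n r _ n _ n] assoc_mult_mat[of _ n r _ r _ n]
        assoc_mult_mat[of _ n r _ n _ r] assoc_mult_mat[of _ r r _ n _ n] assoc_mult_mat[of _ r r _ n _ r])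
  then have "A * H * A\<^sup>T * F * A = A"
    using A by (simp only: inv right_mult_one_mat)
  moreover have "(1\<^sub>m n - A * H * A\<^sup>T * F) * A = 1\<^sub>m n * A - A * H * A\<^sup>T * F * A"
    by (rule minus_mult_distrib_mat) (use A At F H in auto)
  ultimately have "(1\<^sub>m n - A * H * A\<^sup>T * F) * A = A - A"
    using A by simp
  then have "\<Theta>l * (\<Theta>r\<^sup>T * A) = 0\<^sub>m n r"
    unfolding proj assoc_mult_mat[OF L Rt A] using A by auto
  moreover have "\<Theta>r\<^sup>T * \<Theta>l = 1\<^sub>m q"
    using transpose_mult[of "\<Theta>l\<^sup>T" q n \<Theta>r q] L R biorth by simp
  ultimately have "\<Theta>r\<^sup>T * A = \<Theta>r\<^sup>T * 0\<^sub>m n r"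
    using assoc_mult_mat[OF Rt L mult_carrier_mat[OF Rt A]] Rt A by simp
  then show ?thesis
    using Rt by simp
qed

text \<open>
  The matrix \<open>Y\<close> annihilates the range of \<open>A\<close>, which contains the part subtracted from the
  identity in the projector; hence \<open>Y\<close> is unchanged by the projector.
\<close>
lemma annihilator_factors_through_projector:
  fixes A F H Y :: "real mat"
  assumes A: "A \<in> carrier_mat n r" and F: "F \<in> carrier_mat n n" and H: "H \<in> carrier_mat r r"
    and L: "\<Theta>l \<in> carrier_mat n q" and R: "\<Theta>r \<in> carrier_mat n q"
    and proj: "1\<^sub>m n - A * H * A\<^sup>T * F = \<Theta>l * \<Theta>r\<^sup>T"
    and Y: "Y \<in> carrier_mat p n" and YA: "Y * A = 0\<^sub>m p r"
  shows "Y * \<Theta>l * \<Theta>r\<^sup>T = Y"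
proof -
  have C: "H * A\<^sup>T * F \<in> carrier_mat r n"
    using A H F by auto
  have "A * H * A\<^sup>T * F = A * (H * A\<^sup>T * F)"
    using A H F by (simp add: assoc_mult_mat[of _ n r _ r _ n] assoc_mult_mat[of _ n r _ n _ n])
  then have "Y * (A * H * A\<^sup>T * F) = 0\<^sub>m p n"
    using assoc_mult_mat[OF Y A C] left_mult_zero_mat[OF C, of p] by (simp only: YA)
  then have "Y * (1\<^sub>m n - A * H * A\<^sup>T * F) = Y"
    using Y A H F by (subst mult_minus_distrib_mat[of _ p n _ n]) (auto intro!: eq_matI)
  then show ?thesis
    using assoc_mult_mat[OF Y L, of "\<Theta>r\<^sup>T" n] R by (simp add: proj)
qed

section \<open>The augmented system\<close>

lemma saddle_point_system_iff:
  fixes L M :: "real mat"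
  assumes L: "L \<in> carrier_mat n n" and M: "M \<in> carrier_mat n c"
    and b: "b \<in> carrier_vec n" and w: "w \<in> carrier_vec n" and \<Omega>: "\<Omega> \<in> carrier_vec c"
  shows "four_block_mat L M M\<^sup>T (0\<^sub>m c c) *\<^sub>v (w @\<^sub>v \<Omega>) = b @\<^sub>v 0\<^sub>v c \<longleftrightarrow>
    L *\<^sub>v w + M *\<^sub>v \<Omega> = b \<and> M\<^sup>T *\<^sub>v w = 0\<^sub>v c"
proof -
  have Mt: "M\<^sup>T \<in> carrier_mat c n"
    using M by simp
  have "0\<^sub>m c c *\<^sub>v \<Omega> = (0\<^sub>v c :: real vec)"
    using \<Omega> by (intro eq_vecI) auto
  then have "M\<^sup>T *\<^sub>v w + 0\<^sub>m c c *\<^sub>v \<Omega> = M\<^sup>T *\<^sub>v w"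
    using right_zero_vec[OF mult_mat_vec_carrier[OF Mt w]] by simp
  then show ?thesis
    unfolding four_block_mat_mult_vec[OF L M Mt zero_carrier_mat w \<Omega>]
    using L M w \<Omega> b by (subst append_vec_eq[of _ n]) auto
qed

text \<open>
  Eliminating the multiplier: the constraint \<open>M\<^sup>T *\<^sub>v w = 0\<close> says that \<open>w\<close> lies in the range of
  \<open>kron_pow \<Theta> k\<close>, and a multiplier exists exactly if the residual \<open>b - L *\<^sub>v w\<close> lies in the
  range of \<open>M\<close>, which is the kernel of \<open>(kron_pow \<Theta> k)\<^sup>T\<close>.
\<close>
lemma augmented_system_block_row:
  assumes Th: "\<Theta> \<in> carrier_mat n q" and A: "A \<in> carrier_mat n r" and B: "B \<in> carrier_mat n p"
    and X: "X \<in> carrier_mat r n" and R: "R \<in> carrier_mat p q"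
    and one: "A * X + B * (R * \<Theta>\<^sup>T) = 1\<^sub>m n" and ann: "\<Theta>\<^sup>T * A = 0\<^sub>m q r"
    and L: "L \<in> carrier_mat (n ^ k) (n ^ k)" and b: "b \<in> carrier_vec (n ^ k)"
    and w: "w \<in> carrier_vec (n ^ k)"
  shows "(\<exists>\<Omega> \<in> carrier_vec (dim_col (block_row k B A)).
      L *\<^sub>v w + block_row k B A *\<^sub>v \<Omega> = b \<and>
      (block_row k B A)\<^sup>T *\<^sub>v w = 0\<^sub>v (dim_col (block_row k B A))) \<longleftrightarrow>
    (\<exists>u \<in> carrier_vec (q ^ k). w = kron_pow \<Theta> k *\<^sub>v u) \<and>
    (kron_pow \<Theta> k)\<^sup>T *\<^sub>v (L *\<^sub>v w) = (kron_pow \<Theta> k)\<^sup>T *\<^sub>v b"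
    (is "(\<exists>\<Omega> \<in> carrier_vec ?c. _ \<and> ?ker) \<longleftrightarrow> ?rng \<and> ?prj")
proof -
  let ?M = "block_row k B A" and ?T = "(kron_pow \<Theta> k)\<^sup>T"
  have M: "?M \<in> carrier_mat (n ^ k) ?c" and Mt: "?M\<^sup>T \<in> carrier_mat ?c (n ^ k)"
    using block_row_carrier[OF A] by auto
  have K: "kron_pow \<Theta> k \<in> carrier_mat (n ^ k) (q ^ k)" and T: "?T \<in> carrier_mat (q ^ k) (n ^ k)"
    using Th by auto
  have Lw: "L *\<^sub>v w \<in> carrier_vec (n ^ k)"
    using L w by auto
  have MtK: "?M\<^sup>T * kron_pow \<Theta> k = 0\<^sub>m ?c (q ^ k)"
    by (rule transpose_block_row_mult_kron_pow[OF Th A B ann])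
  then have TM: "?T * ?M = 0\<^sub>m (q ^ k) ?c"
    using transpose_mult[OF Mt K] by (metis transpose_transpose zero_transpose_mat)
  show ?thesis
  proof
    assume "\<exists>\<Omega> \<in> carrier_vec ?c. L *\<^sub>v w + ?M *\<^sub>v \<Omega> = b \<and> ?ker"
    then obtain \<Omega> where \<Omega>: "\<Omega> \<in> carrier_vec ?c" "L *\<^sub>v w + ?M *\<^sub>v \<Omega> = b" and ker: ?ker
      by blast
    have "?T *\<^sub>v (?M *\<^sub>v \<Omega>) = 0\<^sub>m (q ^ k) ?c *\<^sub>v \<Omega>"
      using assoc_mult_mat_vec[OF T M \<Omega>(1)] TM by simp
    also have "\<dots> = 0\<^sub>v (q ^ k)"
      using \<Omega>(1) by (intro eq_vecI) auto
    finally have "?T *\<^sub>v (?M *\<^sub>v \<Omega>) = 0\<^sub>v (q ^ k)" .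
    then have ?prj
      using mult_add_distrib_mat_vec[OF T Lw mult_mat_vec_carrier[OF M \<Omega>(1)]] \<Omega>(2)
        right_zero_vec[OF mult_mat_vec_carrier[OF T Lw]] by simp
    moreover have ?rng
      by (rule transpose_block_row_kernel_subset[OF Th A B X R one w ker])
    ultimately show "?rng \<and> ?prj"
      by blast
  next
    assume rhs: "?rng \<and> ?prj"
    then obtain u where u: "u \<in> carrier_vec (q ^ k)" "w = kron_pow \<Theta> k *\<^sub>v u"
      by blast
    have "?M\<^sup>T *\<^sub>v w = 0\<^sub>m ?c (q ^ k) *\<^sub>v u"
      using assoc_mult_mat_vec[OF Mt K u(1)] MtK u(2) by simp
    also have "\<dots> = 0\<^sub>v ?c"
      using u(1) by (intro eq_vecI) auto
    finally have ker: ?ker .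
    have z: "b - L *\<^sub>v w \<in> carrier_vec (n ^ k)"
      using b Lw by auto
    have "?T *\<^sub>v (b - L *\<^sub>v w) = 0\<^sub>v (q ^ k)"
      using mult_minus_distrib_mat_vec[OF T b Lw] rhs mult_mat_vec_carrier[OF T b] by simp
    then obtain \<Omega> where \<Omega>: "\<Omega> \<in> carrier_vec ?c" "?M *\<^sub>v \<Omega> = b - L *\<^sub>v w"
      using kron_pow_annihilator_subset_block_row_range[OF Th A B X R one z] by blast
    have "l + (b - l) = b" if "l \<in> carrier_vec (n ^ k)" for l
      by (rule eq_vecI) (use that b in auto)
    from this[OF Lw] have "L *\<^sub>v w + ?M *\<^sub>v \<Omega> = b"
      unfolding \<Omega>(2) .
    then show "\<exists>\<Omega> \<in> carrier_vec ?c. L *\<^sub>v w + ?M *\<^sub>v \<Omega> = b \<and> ?ker"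
      using \<Omega>(1) ker by blast
  qed
qed

theorem theorem3:
  fixes n1 n2 m p k :: nat
    and \<eta> :: real
    and E11 A11 A12 N B1 C1 \<Theta>l \<Theta>r Ed Ad Bd Cd It W2t W2 Ac M :: "real mat"
    and What :: "nat \<Rightarrow> real mat"
    and J :: "nat set"
    and b wk :: "real vec"
  assumes "n1 > n2" "n2 \<ge> 1" "m \<ge> 1" "p \<ge> 1" "\<eta> \<le> 1" "k > 2"
    and "E11 \<in> carrier_mat n1 n1" "invertible_mat E11"
    and "A11 \<in> carrier_mat n1 n1"
    and "A12 \<in> carrier_mat n1 n2" "vec_space.rank n1 A12 = n2"
    and "invertible_mat (A12\<^sup>T * mat_inv E11 * A12)"
    and "N \<in> carrier_mat n1 (n1\<^sup>2)"
    and "B1 \<in> carrier_mat n1 m"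
    and "C1 \<in> carrier_mat p n1"
    and "\<Theta>l \<in> carrier_mat n1 (n1 - n2)" "\<Theta>r \<in> carrier_mat n1 (n1 - n2)"
    and "1\<^sub>m n1 - A12 * mat_inv (A12\<^sup>T * mat_inv E11 * A12) * A12\<^sup>T * mat_inv E11 = \<Theta>l * \<Theta>r\<^sup>T"
    and "\<Theta>l\<^sup>T * \<Theta>r = 1\<^sub>m (n1 - n2)"
    and "Ed = \<Theta>r\<^sup>T * E11 * \<Theta>r" "Ad = \<Theta>r\<^sup>T * A11 * \<Theta>r" "Bd = \<Theta>r\<^sup>T * B1" "Cd = C1 * \<Theta>r"
    and "stabilizable (mat_inv Ed * Ad) (mat_inv Ed * Bd)"
    and "detectable (mat_inv Ed * Ad) Cd"
    and "card J = n2" "vec_space.basis_columns n2 (A12\<^sup>T) J"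
    and "is_complement_selection n1 J It"
    and "W2t \<in> carrier_mat (n1 - n2) (n1 - n2)" "W2t\<^sup>T = W2t"
    and "W2 = Ed\<^sup>T * W2t * Ed" "sym_pos_def W2"
    and "0\<^sub>m (n1 - n2) (n1 - n2) =
           Ad\<^sup>T * (mat_inv Ed)\<^sup>T * W2 + W2 * mat_inv Ed * Ad + Cd\<^sup>T * Cd
           - \<eta> \<cdot>\<^sub>m (W2 * mat_inv Ed * Bd * Bd\<^sup>T * (mat_inv Ed)\<^sup>T * W2)"
    and "What 2 = \<Theta>r * W2t * \<Theta>r\<^sup>T"
    and "\<And>i. 3 \<le> i \<Longrightarrow> i \<le> k - 1 \<Longrightarrow>
           What i \<in> carrier_mat n1 (n1 ^ (i - 1)) \<and>
           (\<exists>v. solves_projected E11 A11 N B1 \<eta> \<Theta>r What i v \<and>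
                vectorize (What i) = symmetrize n1 i v)"
    and "solves_projected E11 A11 N B1 \<eta> \<Theta>r What k wk"
    and "\<And>v. solves_projected E11 A11 N B1 \<eta> \<Theta>r What k v \<Longrightarrow> v = wk"
    and "b = rhs_vec E11 N B1 \<eta> What k"
    and "Ac = A11 - \<eta> \<cdot>\<^sub>m (B1 * B1\<^sup>T * What 2 * E11)"
    and "M = block_row k It A12"
  shows "(\<exists>w \<in> carrier_vec (n1 ^ k). \<exists>\<Omega> \<in> carrier_vec (dim_col M).
            four_block_mat (lyap k E11\<^sup>T Ac\<^sup>T) M (M\<^sup>T) (0\<^sub>m (dim_col M) (dim_col M))
              *\<^sub>v (w @\<^sub>v \<Omega>) = b @\<^sub>v 0\<^sub>v (dim_col M))
       \<and> (\<forall>w \<in> carrier_vec (n1 ^ k). \<forall>\<Omega> \<in> carrier_vec (dim_col M).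
            four_block_mat (lyap k E11\<^sup>T Ac\<^sup>T) M (M\<^sup>T) (0\<^sub>m (dim_col M) (dim_col M))
              *\<^sub>v (w @\<^sub>v \<Omega>) = b @\<^sub>v 0\<^sub>v (dim_col M) \<longrightarrow> w = wk)"
proof -
  note E11 = assms(7,8) and A11 = assms(9) and A12 = assms(10)
    and Ginv = assms(12) and B1 = assms(14) and \<Theta>l = assms(16) and \<Theta>r = assms(17)
    and proj = assms(18) and biorth = assms(19)
    and J = assms(26,27) and It = assms(28) and W2t = assms(29,30)
    and What2 = assms(34) and wk = assms(36) and uniq = assms(37)
    and b_def = assms(38) and Ac_def = assms(39) and M_def = assms(40)
  let ?F = "mat_inv E11" and ?H = "mat_inv (A12\<^sup>T * mat_inv E11 * A12)"
  have F: "?F \<in> carrier_mat n1 n1"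
    using mat_inv(1)[OF E11] .
  have G: "A12\<^sup>T * ?F * A12 \<in> carrier_mat n2 n2"
    using A12 F by auto
  note H = mat_inv[OF G Ginv]
  have ann: "\<Theta>r\<^sup>T * A12 = 0\<^sub>m (n1 - n2) n2"
    by (rule projector_factor_annihilates[OF A12 F H(1) H(3) \<Theta>l \<Theta>r proj biorth])
  obtain X Y where X: "X \<in> carrier_mat n2 n1" and Y: "Y \<in> carrier_mat (dim_col It) n1"
    and XY: "A12 * X + It * Y = 1\<^sub>m n1" and YA: "Y * A12 = 0\<^sub>m (dim_col It) n2"
    by (rule complement_selection_resolution[OF A12 J(2,1) It])
  have one: "A12 * X + It * (Y * \<Theta>l * \<Theta>r\<^sup>T) = 1\<^sub>m n1"
    unfolding annihilator_factors_through_projector[OF A12 F H(1) \<Theta>l \<Theta>r proj Y YA] by (rule XY)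
  have Itc: "It \<in> carrier_mat n1 (dim_col It)"
    by (rule complement_selection_carrier[OF It])
  let ?L = "lyap k E11\<^sup>T Ac\<^sup>T"
  have What2c: "What 2 \<in> carrier_mat n1 n1"
    using \<Theta>r W2t by (auto simp: What2)
  have What2_sym: "(What 2)\<^sup>T = What 2"
  proof -
    have "(What 2)\<^sup>T = \<Theta>r * (\<Theta>r * W2t)\<^sup>T"
      unfolding What2 using transpose_mult[of "\<Theta>r * W2t" n1 "n1 - n2" "\<Theta>r\<^sup>T" n1] \<Theta>r W2t by simp
    also have "\<dots> = \<Theta>r * (W2t * \<Theta>r\<^sup>T)"
      using transpose_mult[OF \<Theta>r W2t(1)] W2t(2) by simp
    also have "\<dots> = What 2"
      unfolding What2 using \<Theta>r W2t by (intro assoc_mult_mat[symmetric]) auto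
    finally show ?thesis .
  qed
  \<comment> \<open>By symmetry of \<open>What 2\<close>, the augmented and the projected system share their operator.\<close>
  have Act: "Ac\<^sup>T = A11\<^sup>T - \<eta> \<cdot>\<^sub>m (E11\<^sup>T * What 2 * B1 * B1\<^sup>T)"
  proof -
    let ?B = "B1 * B1\<^sup>T"
    have B: "?B \<in> carrier_mat n1 n1" and Bt: "B1\<^sup>T \<in> carrier_mat m n1" and Et: "E11\<^sup>T \<in> carrier_mat n1 n1"
      using B1 E11 by auto
    have "?B\<^sup>T = ?B"
      using transpose_mult[OF B1 Bt] by simp
    then have "(?B * What 2 * E11)\<^sup>T = E11\<^sup>T * (What 2 * ?B)"
      using transpose_mult[OF mult_carrier_mat[OF B What2c] E11(1)] transpose_mult[OF B What2c]
      by (simp add: What2_sym)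
    also have "\<dots> = E11\<^sup>T * What 2 * ?B"
      by (rule assoc_mult_mat[symmetric, OF Et What2c B])
    also have "\<dots> = E11\<^sup>T * What 2 * B1 * B1\<^sup>T"
      by (rule assoc_mult_mat[symmetric, OF mult_carrier_mat[OF Et What2c] B1 Bt])
    finally have "(?B * What 2 * E11)\<^sup>T = E11\<^sup>T * What 2 * B1 * B1\<^sup>T" .
    moreover have P: "?B * What 2 * E11 \<in> carrier_mat n1 n1"
      by (rule mult_carrier_mat[OF mult_carrier_mat[OF B What2c] E11(1)])
    moreover have "(\<eta> \<cdot>\<^sub>m Z)\<^sup>T = \<eta> \<cdot>\<^sub>m Z\<^sup>T" for Z
      by (rule eq_matI) auto
    ultimately show ?thesis
      unfolding Ac_def transpose_minus[OF A11 smult_carrier_mat[OF P]] by (simp only:)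
  qed
  have Ac: "Ac \<in> carrier_mat n1 n1"
    using A11 B1 What2c E11 by (auto simp: Ac_def)
  have L: "?L \<in> carrier_mat (n1 ^ k) (n1 ^ k)"
    using E11(1) Ac power_minus_mult[of k n1] \<open>k > 2\<close> by (intro carrier_matI) (simp_all add: lyap_def)
  have b: "b \<in> carrier_vec (n1 ^ k)"
    using E11(1) by (intro carrier_vecI) (simp add: b_def rhs_vec_def)
  have M: "M \<in> carrier_mat (n1 ^ k) (dim_col M)"
    unfolding M_def by (rule block_row_carrier[OF A12])
  have wkc: "wk \<in> carrier_vec (n1 ^ k)"
  proof -
    obtain u where "u \<in> carrier_vec ((n1 - n2) ^ k)" "wk = kron_pow \<Theta>r k *\<^sub>v u"
      using wk unfolding solves_projected_def carrier_matD(2)[OF \<Theta>r] by blast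
    then show ?thesis
      by (simp only: mult_mat_vec_carrier[OF kron_pow_carrier[OF \<Theta>r]])
  qed
  have iff: "(\<exists>\<Omega> \<in> carrier_vec (dim_col M).
      four_block_mat ?L M (M\<^sup>T) (0\<^sub>m (dim_col M) (dim_col M)) *\<^sub>v (w @\<^sub>v \<Omega>) = b @\<^sub>v 0\<^sub>v (dim_col M)) \<longleftrightarrow>
      solves_projected E11 A11 N B1 \<eta> \<Theta>r What k w" if w: "w \<in> carrier_vec (n1 ^ k)" for w
  proof -
    have "(\<exists>\<Omega> \<in> carrier_vec (dim_col M).
        four_block_mat ?L M (M\<^sup>T) (0\<^sub>m (dim_col M) (dim_col M)) *\<^sub>v (w @\<^sub>v \<Omega>) = b @\<^sub>v 0\<^sub>v (dim_col M)) \<longleftrightarrow>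
        (\<exists>\<Omega> \<in> carrier_vec (dim_col M). ?L *\<^sub>v w + M *\<^sub>v \<Omega> = b \<and> M\<^sup>T *\<^sub>v w = 0\<^sub>v (dim_col M))"
      by (rule bex_cong[OF refl saddle_point_system_iff[OF L M b w]])
    also have "\<dots> \<longleftrightarrow> (\<exists>u \<in> carrier_vec ((n1 - n2) ^ k). w = kron_pow \<Theta>r k *\<^sub>v u) \<and>
        (kron_pow \<Theta>r k)\<^sup>T *\<^sub>v (?L *\<^sub>v w) = (kron_pow \<Theta>r k)\<^sup>T *\<^sub>v b"
      unfolding M_def
      by (rule augmented_system_block_row[OF \<Theta>r A12 Itc X mult_carrier_mat[OF Y \<Theta>l] one ann L b w])
    also have "\<dots> \<longleftrightarrow> solves_projected E11 A11 N B1 \<eta> \<Theta>r What k w"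
      unfolding solves_projected_def Act b_def carrier_matD(2)[OF \<Theta>r] ..
    finally show ?thesis .
  qed
  show ?thesis
  proof (intro conjI ballI impI)
    show "\<exists>w \<in> carrier_vec (n1 ^ k). \<exists>\<Omega> \<in> carrier_vec (dim_col M).
        four_block_mat ?L M (M\<^sup>T) (0\<^sub>m (dim_col M) (dim_col M)) *\<^sub>v (w @\<^sub>v \<Omega>) = b @\<^sub>v 0\<^sub>v (dim_col M)"
      by (rule bexI[OF _ wkc]) (rule iffD2[OF iff[OF wkc] wk])
  next
    fix w \<Omega>
    assume w: "w \<in> carrier_vec (n1 ^ k)" and \<Omega>: "\<Omega> \<in> carrier_vec (dim_col M)"
      and eq: "four_block_mat ?L M (M\<^sup>T) (0\<^sub>m (dim_col M) (dim_col M)) *\<^sub>v (w @\<^sub>v \<Omega>) = b @\<^sub>v 0\<^sub>v (dim_col M)"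
    show "w = wk"
      by (rule uniq, rule iffD1[OF iff[OF w]], rule bexI[OF _ \<Omega>], rule eq)
  qed
qed

end
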